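(* Let $A,B$ be symmetric operators in a real or complex Hilbert space $H$ such that $A$ is essentially selfadjoint and $B$ is $A$-bounded. If $(Ax\,|\,By)=(Bx\,|\,Ay)$ for all $x,y\in\operatorname{dom}A$, then $A+B$ and $B$ are essentially selfadjoint on $\operatorname{dom}A$.
   Context: Operators are (possibly unbounded) linear maps defined on a linear subspace of $H$. An operator $A$ is symmetric if $(Ax\,|\,y)=(x\,|\,Ay)$ for all $x,y\in\operatorname{dom}A$, and essentially selfadjoint if it is closable and its closure is a (densely defined) selfadjoint operator; an operator is essentially selfadjoint on a subspace $\mathscr{D}$ of its domain if its restriction to $\mathscr{D}$ is essentially selfadjoint. $B$ is called $A$-bounded if $\operatorname{dom}A\subseteq\operatorname{dom}B$ and there exist $\alpha,\beta\geq0$ with $\|Bx\|^2\leq\alpha\|Ax\|^2+\beta\|x\|^2$ for all $x\in\operatorname{dom}A$. *)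

theory Defs
  imports "HOL-Analysis.Analysis"
begin

section \<open>Real and complex scalars\<close>

text \<open>
  Up to isomorphism, the only members of this class are the real numbers with the identity and
  the complex numbers with complex conjugation (instances and the converse below): every scalar
  \<open>z\<close> is a root of the real quadratic \<open>t\<^sup>2 - (z + conjugate z) t + z * conjugate z\<close>.
\<close>

class real_or_complex = real_normed_field +
  fixes conjugate :: "'a \<Rightarrow> 'a"
  assumes conjugate_add: "conjugate (z + w) = conjugate z + conjugate w"
    and conjugate_mult: "conjugate (z * w) = conjugate z * conjugate w"
    and conjugate_scaleR: "conjugate (r *\<^sub>R z) = r *\<^sub>R conjugate z"
    and mult_conjugate_scaleR: "z * conjugate z = (norm z)\<^sup>2 *\<^sub>R 1"
    and add_conjugate_scaleR: "\<exists>r. z + conjugate z = r *\<^sub>R 1"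

instantiation real :: real_or_complex
begin
definition conjugate_real :: "real \<Rightarrow> real" where "conjugate_real x = x"
instance
proof
  fix z :: real
  show "\<exists>r. z + conjugate z = r *\<^sub>R 1"
    by (intro exI[of _ "z + z"]) (simp add: conjugate_real_def)
qed (simp_all add: conjugate_real_def power2_eq_square)
end

instantiation complex :: real_or_complex
begin
definition conjugate_complex :: "complex \<Rightarrow> complex" where "conjugate_complex z = cnj z"
instance
proof
  fix z :: complex
  show "\<exists>r. z + conjugate z = r *\<^sub>R 1"
    by (intro exI[of _ "2 * Re z"]) (simp add: conjugate_complex_def complex_eq_iff)
  show "z * conjugate z = (norm z)\<^sup>2 *\<^sub>R 1"
    by (simp add: conjugate_complex_def complex_norm_square scaleR_conv_of_real del: of_real_power)
qed (simp_all add: conjugate_complex_def)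
end

lemma mult_conjugate: "z * conjugate z = of_real ((norm z)\<^sup>2)"
  using mult_conjugate_scaleR[of z] by (simp add: of_real_def)

lemma add_conjugate: "\<exists>r. z + conjugate z = of_real r"
  using add_conjugate_scaleR[of z] by (simp add: of_real_def)

lemma conjugate_of_real: "conjugate (of_real r :: 'k::real_or_complex) = of_real r"
  using conjugate_scaleR[of r "1::'k"] mult_conjugate[of "1::'k"] by (simp add: of_real_def)

lemma real_or_complex_cases:
  "(\<forall>z::'k::real_or_complex. z \<in> range of_real \<and> conjugate z = z) \<or>
   (\<exists>i::'k. i * i = - 1 \<and> conjugate i = - i \<and> (\<forall>z. \<exists>a b. z = of_real a + of_real b * i))"
proof (cases "\<forall>z::'k. z \<in> range of_real")
  case True
  then show ?thesis using conjugate_of_real by (metis rangeE)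
next
  case False
  then obtain w :: 'k where w: "w \<notin> range of_real" by blast
  obtain t where t: "w + conjugate w = of_real t" using add_conjugate by blast
  define v where "v = w - of_real (t / 2)"
  have cw: "conjugate w = of_real t - w" using t by (simp add: algebra_simps)
  have conjugate_diff: "conjugate (x - y) = conjugate x - conjugate y" for x y :: 'k
    using conjugate_add[of "x - y" y] by (simp add: algebra_simps)
  have cv: "conjugate v = - v"
    unfolding v_def conjugate_diff cw conjugate_of_real by (simp add: field_simps)
  have v0: "v \<noteq> 0" using w unfolding v_def by (metis eq_iff_diff_eq_0 rangeI)
  have vv: "v * v = - of_real ((norm v)\<^sup>2)" using mult_conjugate[of v] cv
    by (metis mult_minus_right minus_equation_iff)
  define i where "i = v / of_real (norm v)"
  have n0: "of_real (norm v) \<noteq> (0::'k)" using v0 by simp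
  have ii: "i * i = - 1" using vv n0 by (simp add: i_def field_simps power2_eq_square)
  have vi: "v = i * of_real (norm v)" using n0 by (simp add: i_def)
  have "conjugate i * of_real (norm v) = - i * of_real (norm v)"
    using cv vi conjugate_mult[of i "of_real (norm v)"] conjugate_of_real
    by (metis mult_minus_left)
  then have ci: "conjugate i = - i" using n0 mult_right_cancel by blast
  have "\<exists>a b. z = of_real a + of_real b * i" for z :: 'k
  proof -
    obtain r where r: "z + conjugate z = of_real r" using add_conjugate by blast
    obtain s where s: "z * i + conjugate (z * i) = of_real s" using add_conjugate by blast
    have cz: "conjugate z = of_real r - z" using r by (simp add: algebra_simps)
    have "2 * (z * i) = of_real s + of_real r * i"
      using s by (simp add: conjugate_mult ci cz algebra_simps)
    then have "2 * (z * i) * i = (of_real s + of_real r * i) * i" by simp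
    then have "- (2 * z) = of_real s * i - of_real r"
      by (simp add: distrib_right mult.assoc ii)
    then have "z = of_real (r / 2) + of_real (- s / 2) * i" by (simp add: field_simps)
    then show ?thesis by blast
  qed
  then show ?thesis using ii ci by blast
qed


section \<open>Hilbert spaces over such a scalar field\<close>

text \<open>
  The inner product \<open>ip\<close> is linear in its first argument. Norm, topology and completeness are
  those of the sort of \<open>'h\<close>; the last two axioms make them the ones induced by \<open>ip\<close> and
  make the real scalar multiplication of that sort the restriction of \<open>smul\<close>.
\<close>

locale hilbert_space = vector_space smul
  for smul :: "'k::real_or_complex \<Rightarrow> 'h::{real_normed_vector, complete_space} \<Rightarrow> 'h" +
  fixes ip :: "'h \<Rightarrow> 'h \<Rightarrow> 'k"
  assumes ip_add_left: "ip (x + y) z = ip x z + ip y z"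
    and ip_scale_left: "ip (smul c x) y = c * ip x y"
    and ip_commute: "ip y x = conjugate (ip x y)"
    and ip_self: "ip x x = of_real ((norm x)\<^sup>2)"
    and scale_of_real: "smul (of_real r) x = r *\<^sub>R x"

lemma hilbert_space_real_inner:
  "hilbert_space (*\<^sub>R) (inner :: 'h::{real_inner, complete_space} \<Rightarrow> 'h \<Rightarrow> real)"
  by unfold_locales
    (auto simp: inner_simps inner_commute conjugate_real_def power2_norm_eq_inner
      scaleR_add_right scaleR_add_left)

lemma hilbert_space_complex: "hilbert_space (*) (\<lambda>x y :: complex. x * cnj y)"
  by unfold_locales
    (auto simp: algebra_simps conjugate_complex_def complex_norm_square scaleR_conv_of_real
      simp del: of_real_power)


section \<open>Unbounded operators\<close>

text \<open>
  An operator is a partial map; the library's \<^const>\<open>dom\<close>, restriction \<open>A |` D\<close> and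
  \<^const>\<open>Map.graph\<close> are its domain, restriction and graph.
\<close>

definition app :: "('h \<rightharpoonup> 'h) \<Rightarrow> 'h \<Rightarrow> 'h"
  where "app A x = the (A x)"

definition linear_operator :: "('k::field \<Rightarrow> 'h::ab_group_add \<Rightarrow> 'h) \<Rightarrow> ('h \<rightharpoonup> 'h) \<Rightarrow> bool"
  where "linear_operator smul A \<longleftrightarrow>
    module.subspace smul (dom A) \<and>
    (\<forall>x\<in>dom A. \<forall>y\<in>dom A. app A (x + y) = app A x + app A y) \<and>
    (\<forall>c. \<forall>x\<in>dom A. app A (smul c x) = smul c (app A x))"

definition op_sum :: "('h::plus \<rightharpoonup> 'h) \<Rightarrow> ('h \<rightharpoonup> 'h) \<Rightarrow> ('h \<rightharpoonup> 'h)"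
  where "op_sum A B = (\<lambda>x. if x \<in> dom A \<inter> dom B then Some (app A x + app B x) else None)"

definition symmetric_op :: "('h \<Rightarrow> 'h \<Rightarrow> 'k) \<Rightarrow> ('h \<rightharpoonup> 'h) \<Rightarrow> bool"
  where "symmetric_op ip A \<longleftrightarrow> (\<forall>x\<in>dom A. \<forall>y\<in>dom A. ip (app A x) y = ip x (app A y))"

definition rel_bounded :: "('h::real_normed_vector \<rightharpoonup> 'h) \<Rightarrow> ('h \<rightharpoonup> 'h) \<Rightarrow> bool"
  where "rel_bounded A B \<longleftrightarrow> dom A \<subseteq> dom B \<and>
    (\<exists>\<alpha>\<ge>0. \<exists>\<beta>\<ge>0. \<forall>x\<in>dom A.
      (norm (app B x))\<^sup>2 \<le> \<alpha> * (norm (app A x))\<^sup>2 + \<beta> * (norm x)\<^sup>2)"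

definition closable :: "('h::topological_space \<rightharpoonup> 'h) \<Rightarrow> bool"
  where "closable A \<longleftrightarrow> (\<exists>C. Map.graph C = closure (Map.graph A))"

definition op_closure :: "('h::topological_space \<rightharpoonup> 'h) \<Rightarrow> ('h \<rightharpoonup> 'h)"
  where "op_closure A = (THE C. Map.graph C = closure (Map.graph A))"

text \<open>
  The vector \<open>z\<close> below is unique only if \<open>A\<close> is densely defined; \<open>adjoint_op\<close> is meaningless
  otherwise.
\<close>

definition adjoint_op :: "('h \<Rightarrow> 'h \<Rightarrow> 'k) \<Rightarrow> ('h \<rightharpoonup> 'h) \<Rightarrow> ('h \<rightharpoonup> 'h)"
  where "adjoint_op ip A = (\<lambda>y.
    if \<exists>z. \<forall>x\<in>dom A. ip (app A x) y = ip x z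
    then Some (THE z. \<forall>x\<in>dom A. ip (app A x) y = ip x z) else None)"

definition selfadjoint :: "('h::topological_space \<Rightarrow> 'h \<Rightarrow> 'k) \<Rightarrow> ('h \<rightharpoonup> 'h) \<Rightarrow> bool"
  where "selfadjoint ip A \<longleftrightarrow> closure (dom A) = UNIV \<and> adjoint_op ip A = A"

definition essentially_selfadjoint ::
    "('h::topological_space \<Rightarrow> 'h \<Rightarrow> 'k) \<Rightarrow> ('h \<rightharpoonup> 'h) \<Rightarrow> bool"
  where "essentially_selfadjoint ip A \<longleftrightarrow> closable A \<and> selfadjoint ip (op_closure A)"

definition essentially_selfadjoint_on ::
    "('k::field \<Rightarrow> 'h::{ab_group_add, topological_space} \<Rightarrow> 'h) \<Rightarrow> ('h \<Rightarrow> 'h \<Rightarrow> 'k) \<Rightarrow>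
      ('h \<rightharpoonup> 'h) \<Rightarrow> 'h set \<Rightarrow> bool"
  where "essentially_selfadjoint_on smul ip A D \<longleftrightarrow>
    module.subspace smul D \<and> D \<subseteq> dom A \<and> essentially_selfadjoint ip (A |` D)"

end

theory Submission
  imports Defs
begin

text \<open>
  Let \<open>T\<close> be the closure of \<open>A\<close>. By relative boundedness \<open>B\<close> extends to a symmetric operator \<open>S\<close>
  on the domain of \<open>T\<close> that is contained in the closure of \<open>B\<close> and satisfies
  \<open>(T x | S y) = (S x | T y)\<close>. The bounded operators \<open>J = (1 + \<epsilon>\<^sup>2T\<^sup>2)\<^sup>-\<^sup>1\<close>, available over real
  scalars too, are symmetric, converge strongly to the identity as \<open>\<epsilon> \<rightarrow> 0\<close>, and the commutation
  relation gives \<open>(z | S J v) = (S J z | v)\<close> for all \<open>z\<close> and \<open>v\<close>. Hence \<open>S J z = J B\<^sup>* z\<close> for \<open>z\<close> in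
  the domain of \<open>B\<^sup>*\<close>, and letting \<open>\<epsilon> \<rightarrow> 0\<close> puts \<open>(z, B\<^sup>* z)\<close> in the closed graph of \<open>B\<close>. The
  hypotheses on \<open>B\<close> pass to \<open>A + B\<close>.
\<close>

section \<open>Nearest points in closed convex sets\<close>

text \<open>The parallelogram law makes a minimizing sequence Cauchy. It is a hypothesis on the norm
  so that the lemma applies to the product type \<open>'h \<times> 'h\<close> as well.\<close>

lemma nearest_point_exists:
  fixes M :: "'a::{real_normed_vector, complete_space} set"
  assumes par: "\<And>x y::'a. (norm (x + y))\<^sup>2 + (norm (x - y))\<^sup>2 = 2 * (norm x)\<^sup>2 + 2 * (norm y)\<^sup>2"
    and "closed M" "convex M" "M \<noteq> {}"
  obtains p where "p \<in> M" "\<And>q. q \<in> M \<Longrightarrow> norm (z - p) \<le> norm (z - q)"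
proof -
  define d where "d = infdist z M"
  have d0: "0 \<le> d" by (simp add: d_def infdist_nonneg)
  have dle: "d \<le> norm (z - q)" if "q \<in> M" for q
    using infdist_le[OF that, of z] by (simp add: d_def dist_norm)
  have "\<exists>q\<in>M. norm (z - q) < d + inverse (real (Suc n))" for n
  proof (rule ccontr)
    assume "\<not> ?thesis"
    then have "d + inverse (real (Suc n)) \<le> infdist z M"
      using \<open>M \<noteq> {}\<close> unfolding infdist_def
      by (auto simp: dist_norm not_less intro!: cINF_greatest)
    then show False unfolding d_def by (simp add: field_simps)
  qed
  then obtain p where pM: "p n \<in> M" and pd: "norm (z - p n) < d + inverse (real (Suc n))" for n
    by metis
  have "(\<lambda>n. norm (z - p n)) \<longlonglongrightarrow> d"
  proof (rule tendsto_sandwich[OF _ _ tendsto_const])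
    show "(\<lambda>n. d + inverse (real (Suc n))) \<longlonglongrightarrow> d"
      using tendsto_add[OF tendsto_const LIMSEQ_inverse_real_of_nat] by simp
  qed (use dle pM less_imp_le[OF pd] in \<open>auto intro!: always_eventually\<close>)
  then have sq: "(\<lambda>n. (norm (z - p n))\<^sup>2) \<longlonglongrightarrow> d\<^sup>2" by (rule tendsto_power)
  \<comment> \<open>The midpoint of \<open>p m\<close> and \<open>p n\<close> lies in
    \<open>M\<close>, so its distance from \<open>z\<close> is at least \<open>d\<close>; the
    parallelogram law turns this into a bound on the gap.\<close>
  have gap: "(norm (p m - p n))\<^sup>2 \<le> 2 * (norm (z - p m))\<^sup>2 + 2 * (norm (z - p n))\<^sup>2 - 4 * d\<^sup>2" for m n
  proof -
    have mid: "(1/2) *\<^sub>R p m + (1/2) *\<^sub>R p n \<in> M"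
      using \<open>convex M\<close> pM by (auto simp: convex_def)
    have "(z - p m) + (z - p n) = 2 *\<^sub>R (z - ((1/2) *\<^sub>R p m + (1/2) *\<^sub>R p n))"
      by (simp add: algebra_simps scaleR_2)
    then have "norm ((z - p m) + (z - p n)) = 2 * norm (z - ((1/2) *\<^sub>R p m + (1/2) *\<^sub>R p n))"
      by simp
    then have "2 * d \<le> norm ((z - p m) + (z - p n))" using dle[OF mid] by simp
    then have "(2 * d)\<^sup>2 \<le> (norm ((z - p m) + (z - p n)))\<^sup>2" by (rule power_mono) (use d0 in simp)
    then show ?thesis using par[of "z - p m" "z - p n"]
      by (simp add: power_mult_distrib norm_minus_commute)
  qed
  have "Cauchy p"
  proof (rule metric_CauchyI)
    fix e :: real assume "0 < e"
    \<comment> \<open>Two terms of this size, each doubled in \<open>gap\<close>, exceed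
      \<open>4 * d\<^sup>2\<close> by less than \<open>e\<^sup>2\<close>.\<close>
    then have "eventually (\<lambda>n. (norm (z - p n))\<^sup>2 < d\<^sup>2 + e\<^sup>2 / 4) sequentially"
      using order_tendstoD(2)[OF sq, of "d\<^sup>2 + e\<^sup>2 / 4"] by simp
    then obtain N where N: "\<And>n. n \<ge> N \<Longrightarrow> (norm (z - p n))\<^sup>2 < d\<^sup>2 + e\<^sup>2 / 4"
      by (auto simp: eventually_sequentially)
    have "dist (p m) (p n) < e" if "m \<ge> N" "n \<ge> N" for m n
    proof -
      have "(norm (p m - p n))\<^sup>2 < e\<^sup>2" using gap[of m n] N[OF that(1)] N[OF that(2)] by simp
      then show ?thesis using \<open>0 < e\<close> by (simp add: dist_norm power_less_imp_less_base)
    qed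
    then show "\<exists>N. \<forall>m\<ge>N. \<forall>n\<ge>N. dist (p m) (p n) < e" by blast
  qed
  then obtain l where l: "p \<longlonglongrightarrow> l" using Cauchy_convergent convergent_def by blast
  have "l \<in> M" using closed_sequentially[OF \<open>closed M\<close>] pM l by blast
  moreover have "norm (z - l) = d"
    using \<open>(\<lambda>n. norm (z - p n)) \<longlonglongrightarrow> d\<close> l
    by (intro LIMSEQ_unique[of "\<lambda>n. norm (z - p n)"] tendsto_intros)
  ultimately show thesis using that dle by metis
qed

section \<open>Conjugation, identities on closures, graphs of partial maps\<close>

lemma conjugate_conjugate: "conjugate (conjugate z) = (z::'k::real_or_complex)"
proof -
  obtain r where r: "z + conjugate z = of_real r" using add_conjugate by blast
  then have "conjugate z + conjugate (conjugate z) = of_real r"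
    by (metis conjugate_add conjugate_of_real)
  with r show ?thesis by (metis add.commute add_left_imp_eq)
qed

lemma conjugate_0: "conjugate (0::'k::real_or_complex) = 0"
  using conjugate_of_real[of 0] by simp

lemma conjugate_minus: "conjugate (- z) = - conjugate (z::'k::real_or_complex)"
  using conjugate_scaleR[of "-1" z] by simp

text \<open>Carries sesquilinear identities, such as symmetry and the commutation relation, from
  pairs of points of a graph to pairs of points of its closure.\<close>

lemma eq_on_closure_Times:
  fixes f g :: "'a::topological_space \<times> 'b::topological_space \<Rightarrow> 'c::t2_space"
  assumes "p \<in> closure M" "q \<in> closure N" "\<And>p q. p \<in> M \<Longrightarrow> q \<in> N \<Longrightarrow> f (p, q) = g (p, q)"
    and "continuous_on UNIV f" "continuous_on UNIV g"
  shows "f (p, q) = g (p, q)"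
proof -
  have "closed {r. f r = g r}" by (intro closed_Collect_eq assms)
  then have "closure (M \<times> N) \<subseteq> {r. f r = g r}" using assms(3) by (intro closure_minimal) auto
  then show ?thesis using assms(1,2) by (auto simp: closure_Times)
qed

lemma dom_eq_of_graph: "dom C = fst ` Map.graph C"
  by (force simp: graph_def dom_def image_iff)

lemma graph_inj:
  assumes "Map.graph C = Map.graph C'"
  shows "C = C'"
proof
  fix x
  have "C x = Some y \<longleftrightarrow> C' x = Some y" for y
    using assms by (metis in_graphD in_graphI)
  then show "C x = C' x" by (metis option.exhaust)
qed

lemma graph_op_closure: "closable A \<Longrightarrow> Map.graph (op_closure A) = closure (Map.graph A)"
  unfolding closable_def op_closure_def by (metis (mono_tags, lifting) graph_inj theI)

lemma dom_closure_graph: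
  assumes "closable A" shows "dom A \<subseteq> dom (op_closure A)" "dom (op_closure A) \<subseteq> closure (dom A)"
proof -
  show "dom A \<subseteq> dom (op_closure A)"
    unfolding dom_eq_of_graph graph_op_closure[OF assms] by (intro image_mono closure_subset)
  show "dom (op_closure A) \<subseteq> closure (dom A)"
    unfolding dom_eq_of_graph graph_op_closure[OF assms]
    by (rule image_closure_subset) (auto intro!: continuous_intros subsetD[OF closure_subset])
qed

section \<open>Inner product calculus over real or complex scalars\<close>

context hilbert_space
begin

lemma ip_add_right: "ip x (y + z) = ip x y + ip x z"
  by (metis ip_commute ip_add_left conjugate_add)

lemma ip_scale_right: "ip x (smul c y) = conjugate c * ip x y"
  by (metis ip_commute ip_scale_left conjugate_mult)

lemma ip_minus_left: "ip (- x) y = - ip x y"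
  using ip_scale_left[of "-1" x y] by simp

lemma ip_minus_right: "ip x (- y) = - ip x y"
  by (metis ip_commute ip_minus_left conjugate_minus)

lemma ip_diff_left: "ip (x - y) z = ip x z - ip y z"
  using ip_add_left[of x "- y" z] by (simp add: ip_minus_left)

lemma ip_diff_right: "ip x (y - z) = ip x y - ip x z"
  using ip_add_right[of x y "- z"] by (simp add: ip_minus_right)

lemma ip_scaleR_left: "ip (r *\<^sub>R x) y = of_real r * ip x y"
  by (metis ip_scale_left scale_of_real)

lemma ip_scaleR_right: "ip x (r *\<^sub>R y) = of_real r * ip x y"
  by (metis ip_scale_right scale_of_real conjugate_of_real)

lemma parallelogram:
  fixes x y :: 'h
  shows "(norm (x + y))\<^sup>2 + (norm (x - y))\<^sup>2 = 2 * (norm x)\<^sup>2 + 2 * (norm y)\<^sup>2"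
proof -
  have "(of_real ((norm (x + y))\<^sup>2 + (norm (x - y))\<^sup>2) :: 'k) =
      of_real (2 * (norm x)\<^sup>2 + 2 * (norm y)\<^sup>2)"
    unfolding of_real_add of_real_mult ip_self[symmetric]
    by (simp add: ip_add_left ip_add_right ip_diff_left ip_diff_right)
  then show ?thesis by (simp only: of_real_eq_iff)
qed

text \<open>For nonreal scalars the norm is tied to \<open>smul\<close> only through
  \<open>ip_self\<close>, so homogeneity is read off from the inner product and
  \<open>c * conjugate c\<close>.\<close>

lemma norm_smul: "norm (smul c x) = norm c * norm x"
proof -
  have "(of_real ((norm (smul c x))\<^sup>2) :: 'k) = of_real ((norm c * norm x)\<^sup>2)"
    unfolding ip_self[symmetric] ip_scale_left ip_scale_right
    by (simp add: ip_self mult.assoc[symmetric] mult_conjugate mult.commute[of "conjugate c"]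
        power_mult_distrib)
  then show ?thesis by (simp only: of_real_eq_iff) (simp add: power2_eq_iff_nonneg)
qed

lemma bounded_linear_smul: "bounded_linear (smul c)"
proof (rule bounded_linear_intro[where K = "norm c"])
  show "smul c (r *\<^sub>R x) = r *\<^sub>R smul c x" for r x
    by (metis scale_of_real scale_scale mult.commute)
qed (simp_all add: scale_right_distrib norm_smul mult.commute)

text \<open>Expansion of the squared norm along the direction \<open>smul d y\<close> with a real
  step \<open>t\<close>. It is stated in the scalar field, where a real part would be half of a sum
  of conjugates.\<close>

lemma ip_variation:
  fixes a y :: 'h and t :: real and d :: 'k
  shows "of_real ((norm (a - smul (of_real t * d) y))\<^sup>2) =
    of_real ((norm a)\<^sup>2) - of_real t * (d * conjugate (ip a y) + conjugate d * ip a y)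
      + of_real (t\<^sup>2 * (norm d)\<^sup>2 * (norm y)\<^sup>2)"
proof -
  have "ip (a - smul (of_real t * d) y) (a - smul (of_real t * d) y) =
    ip a a - of_real t * (d * ip y a + conjugate d * ip a y)
      + of_real t * of_real t * (d * conjugate d) * ip y y"
    by (simp add: ip_diff_left ip_diff_right ip_scale_left ip_scale_right conjugate_mult
        conjugate_of_real algebra_simps)
  then show ?thesis
    unfolding ip_self mult_conjugate ip_commute[of y a] by (simp add: power2_eq_square)
qed

lemma Cauchy_Schwarz: "norm (ip x y) \<le> norm x * norm y"
proof (cases "y = 0")
  case True
  then show ?thesis using ip_scale_right[of x 0 0] by (simp add: conjugate_0)
next
  case False
  \<comment> \<open>With this step \<open>smul (of_real t * ip x y) y\<close> is the orthogonal
    projection of \<open>x\<close> onto the line through \<open>y\<close>.\<close>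
  define t where "t = 1 / (norm y)\<^sup>2"
  have "(of_real ((norm (x - smul (of_real t * ip x y) y))\<^sup>2) :: 'k) =
    of_real ((norm x)\<^sup>2 - 2 * t * (norm (ip x y))\<^sup>2 + t\<^sup>2 * (norm (ip x y))\<^sup>2 * (norm y)\<^sup>2)"
    unfolding ip_variation by (simp add: mult_conjugate mult.commute[of "conjugate _"])
  then have "0 \<le> (norm x)\<^sup>2 - 2 * t * (norm (ip x y))\<^sup>2 + t\<^sup>2 * (norm (ip x y))\<^sup>2 * (norm y)\<^sup>2"
    by (metis of_real_eq_iff zero_le_power2)
  also have "\<dots> = (norm x)\<^sup>2 - (norm (ip x y))\<^sup>2 / (norm y)\<^sup>2"
    using False by (simp add: t_def power2_eq_square)
  finally have "(norm (ip x y))\<^sup>2 \<le> (norm x * norm y)\<^sup>2"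
    using False by (simp add: field_simps power_mult_distrib)
  then show ?thesis by (rule power2_le_imp_le) simp
qed

lemma bounded_bilinear_ip: "bounded_bilinear ip"
proof
  show "\<exists>K. \<forall>a b. norm (ip a b) \<le> norm a * norm b * K"
    using Cauchy_Schwarz by (intro exI[of _ 1]) simp
qed (simp_all add: ip_add_left ip_add_right ip_scaleR_left ip_scaleR_right scaleR_conv_of_real)

lemmas continuous_on_ip [continuous_intros] = bounded_bilinear.continuous_on[OF bounded_bilinear_ip]

text \<open>Euler equation for a minimum in the orthogonal sum of two copies of the space. Moving
  along the value \<open>d\<close> of the left-hand side lowers the functional to first order unless
  \<open>d = 0\<close>; this choice works for both scalar fields.\<close>

lemma orthogonal_of_minimal:
  assumes "\<And>c. (norm a)\<^sup>2 + (norm b)\<^sup>2 \<le> (norm (a - smul c y))\<^sup>2 + (norm (b - smul c v))\<^sup>2"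
  shows "ip a y + ip b v = 0"
proof -
  define d where "d = ip a y + ip b v"
  define N where "N = (norm y)\<^sup>2 + (norm v)\<^sup>2"
  have "N \<ge> 0" by (simp add: N_def)
  \<comment> \<open>Small enough for the linear decrease to beat the quadratic term, and well
    defined even when \<open>N = 0\<close>.\<close>
  define t where "t = 1 / (N + 1)"
  have "(of_real ((norm (a - smul (of_real t * d) y))\<^sup>2 + (norm (b - smul (of_real t * d) v))\<^sup>2) :: 'k)
    = of_real ((norm a)\<^sup>2 + (norm b)\<^sup>2) - of_real t * (d * conjugate d + d * conjugate d)
      + of_real (t\<^sup>2 * (norm d)\<^sup>2 * N)"
    unfolding of_real_add ip_variation
    by (simp add: d_def N_def conjugate_add algebra_simps)
  also have "\<dots> = of_real ((norm a)\<^sup>2 + (norm b)\<^sup>2 - 2 * t * (norm d)\<^sup>2 + t\<^sup>2 * (norm d)\<^sup>2 * N)"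
    by (simp add: mult_conjugate)
  finally have "(norm (a - smul (of_real t * d) y))\<^sup>2 + (norm (b - smul (of_real t * d) v))\<^sup>2
    = (norm a)\<^sup>2 + (norm b)\<^sup>2 - 2 * t * (norm d)\<^sup>2 + t\<^sup>2 * (norm d)\<^sup>2 * N"
    by (simp only: of_real_eq_iff)
  with assms[of "of_real t * d"] have "0 \<le> - 2 * t * (norm d)\<^sup>2 + t\<^sup>2 * (norm d)\<^sup>2 * N" by simp
  also have "\<dots> = - ((norm d)\<^sup>2 * (t * (2 - t * N)))" by (simp add: power2_eq_square algebra_simps)
  finally have "(norm d)\<^sup>2 * (t * (2 - t * N)) \<le> 0" by simp
  moreover have "t > 0" "t * N < 2" using \<open>N \<ge> 0\<close> by (simp_all add: t_def field_simps)
  then have "t * (2 - t * N) > 0" by simp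
  ultimately have "(norm d)\<^sup>2 \<le> 0" by (smt (verit) mult_pos_pos)
  then show ?thesis by (simp add: d_def)
qed

lemma eq_of_ip_dense:
  assumes "closure D = UNIV" "\<And>v. v \<in> D \<Longrightarrow> ip s v = ip x v"
  shows "s = x"
proof -
  have "closed {v. ip s v = ip x v}" by (intro closed_Collect_eq continuous_intros)
  then have "closure D \<subseteq> {v. ip s v = ip x v}" using assms(2) by (intro closure_minimal) auto
  then have "ip s (s - x) = ip x (s - x)" using assms(1) by auto
  then have "ip (s - x) (s - x) = 0" by (simp add: ip_diff_left)
  then show ?thesis by (simp add: ip_self)
qed

section \<open>Symmetry and selfadjointness in terms of closed graphs\<close>

lemma symmetric_graph_closure:
  assumes "symmetric_op ip A" "(x, u) \<in> closure (Map.graph A)" "(y, v) \<in> closure (Map.graph A)"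
  shows "ip u y = ip x v"
proof -
  have "(\<lambda>r. ip (snd (fst r)) (fst (snd r))) ((x, u), (y, v)) =
      (\<lambda>r. ip (fst (fst r)) (snd (snd r))) ((x, u), (y, v))"
    by (rule eq_on_closure_Times[OF assms(2,3)])
      (use assms(1) in \<open>force simp: symmetric_op_def graph_def app_def dom_def
        intro!: continuous_intros\<close>)+
  then show ?thesis by simp
qed

text \<open>Two limits over the same \<open>x\<close> have the same inner product with every vector
  of the dense domain, by symmetry, and hence agree.\<close>

lemma closable_symmetric:
  assumes sym: "symmetric_op ip A" and dense: "closure (dom A) = UNIV"
  shows "closable A"
proof -
  define G where "G = closure (Map.graph A)"
  have uniq: "u = u'" if "(x, u) \<in> G" "(x, u') \<in> G" for x u u'
  proof (rule eq_of_ip_dense[OF dense])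
    fix v assume "v \<in> dom A"
    then have "(v, app A v) \<in> G"
      unfolding G_def by (intro subsetD[OF closure_subset]) (auto simp: graph_def app_def)
    then show "ip u v = ip u' v"
      using symmetric_graph_closure[OF sym] that unfolding G_def by metis
  qed
  have "Map.graph (\<lambda>x. if \<exists>u. (x, u) \<in> G then Some (THE u. (x, u) \<in> G) else None) = G"
    using uniq by (auto simp: graph_def split: if_splits) (metis the_equality)+
  then show ?thesis unfolding closable_def G_def by blast
qed

text \<open>Symmetry already places the closure inside its adjoint; the assumption
  \<open>max\<close> supplies the reverse inclusion, since the adjoint of the closure is contained
  in that of \<open>A\<close>.\<close>

lemma essentially_selfadjointI:
  assumes sym: "symmetric_op ip A" and dense: "closure (dom A) = UNIV"
    and max: "\<And>y z. (\<And>x. x \<in> dom A \<Longrightarrow> ip (app A x) y = ip x z) \<Longrightarrow> (y, z) \<in> closure (Map.graph A)"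
  shows "essentially_selfadjoint ip A"
proof -
  have clos: "closable A" by (rule closable_symmetric[OF sym dense])
  define C where "C = op_closure A"
  have G: "Map.graph C = closure (Map.graph A)" unfolding C_def by (rule graph_op_closure[OF clos])
  have inG: "(x, u) \<in> closure (Map.graph A) \<longleftrightarrow> C x = Some u" for x u
    unfolding G[symmetric] by (simp add: graph_def)
  have denseC: "closure (dom C) = UNIV"
    using closure_mono[OF dom_closure_graph(1)[OF clos]] dense unfolding C_def by auto
  have char: "(\<forall>x\<in>dom C. ip (app C x) y = ip x z) \<longleftrightarrow> C y = Some z" for y z
  proof
    assume C: "C y = Some z"
    show "\<forall>x\<in>dom C. ip (app C x) y = ip x z"
      using symmetric_graph_closure[OF sym] C unfolding inG by (auto simp: app_def)
  next
    assume *: "\<forall>x\<in>dom C. ip (app C x) y = ip x z"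
    have "(y, z) \<in> closure (Map.graph A)"
    proof (rule max)
      fix x assume x: "x \<in> dom A"
      then have "(x, app A x) \<in> closure (Map.graph A)"
        by (intro subsetD[OF closure_subset]) (auto simp: graph_def app_def)
      then have "C x = Some (app A x)" by (simp add: inG)
      with * show "ip (app A x) y = ip x z" by (metis app_def domI option.sel)
    qed
    then show "C y = Some z" by (simp add: inG)
  qed
  have "adjoint_op ip C = C"
  proof
    show "adjoint_op ip C y = C y" for y
      unfolding adjoint_op_def char by (cases "C y") auto
  qed
  then show ?thesis unfolding essentially_selfadjoint_def selfadjoint_def
    using clos denseC by (simp add: C_def)
qed

text \<open>Expresses selfadjointness through the closed graph of \<open>A\<close> alone, so that
  the analytic arguments can avoid \<open>op_closure\<close> and \<open>adjoint_op\<close>. Density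
  makes the \<open>THE\<close> in the adjoint well defined.\<close>

lemma essentially_selfadjointD:
  assumes "essentially_selfadjoint ip A"
  shows "closure (dom A) = UNIV"
    and "(\<And>x u. (x, u) \<in> closure (Map.graph A) \<Longrightarrow> ip u y = ip x z) \<Longrightarrow> (y, z) \<in> closure (Map.graph A)"
proof -
  define C where "C = op_closure A"
  have clos: "closable A" and denseC: "closure (dom C) = UNIV" and adj: "adjoint_op ip C = C"
    using assms by (auto simp: essentially_selfadjoint_def selfadjoint_def C_def)
  show "closure (dom A) = UNIV"
    using closure_mono[OF dom_closure_graph(2)[OF clos]] denseC unfolding C_def by auto
  have inG: "(x, u) \<in> closure (Map.graph A) \<longleftrightarrow> C x = Some u" for x u
    unfolding graph_op_closure[OF clos, symmetric] C_def by (simp add: graph_def)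
  assume *: "\<And>x u. (x, u) \<in> closure (Map.graph A) \<Longrightarrow> ip u y = ip x z"
  have P: "\<forall>x\<in>dom C. ip (app C x) y = ip x z" using * unfolding inG by (auto simp: app_def)
  have "z' = z" if "\<forall>x\<in>dom C. ip (app C x) y = ip x z'" for z'
  proof (rule eq_of_ip_dense[OF denseC])
    fix v assume "v \<in> dom C"
    then have "ip v z' = ip v z" using that P by metis
    then show "ip z' v = ip z v" by (metis ip_commute)
  qed
  with P have "(THE z. \<forall>x\<in>dom C. ip (app C x) y = ip x z) = z" by (rule the_equality)
  moreover from P have "\<exists>z. \<forall>x\<in>dom C. ip (app C x) y = ip x z" by (rule exI)
  ultimately have "adjoint_op ip C y = Some z" by (simp only: adjoint_op_def if_True)
  then show "(y, z) \<in> closure (Map.graph A)" unfolding inG adj .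
qed

section \<open>The regularizing resolvent of the squared closure\<close>

text \<open>A continuous map sending pairs from the graph into the graph does the same for the
  closures. The form \<open>x - smul c y\<close> serves both convex combinations and
  variations.\<close>

lemma linear_graph_closure:
  assumes "linear_operator smul A" "(x, u) \<in> closure (Map.graph A)" "(y, v) \<in> closure (Map.graph A)"
  shows "(x - smul c y, u - smul c v) \<in> closure (Map.graph A)"
proof -
  define f where "f r = (fst (fst r) - smul c (fst (snd r)), snd (fst r) - smul c (snd (snd r)))"
    for r :: "('h \<times> 'h) \<times> ('h \<times> 'h)"
  have cont: "continuous_on S f" for S
    unfolding f_def by (intro continuous_intros bounded_linear.continuous_on[OF bounded_linear_smul])
  have lin: "f (p, q) \<in> Map.graph A" if "p \<in> Map.graph A" "q \<in> Map.graph A" for p q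
  proof -
    obtain x u y v where p: "p = (x, u)" "q = (y, v)" by (metis prod.exhaust)
    then have xy: "x \<in> dom A" "u = app A x" "y \<in> dom A" "v = app A y"
      using that by (auto simp: graph_def app_def)
    have sub: "subspace (dom A)" using assms(1) by (simp add: linear_operator_def)
    then have my: "smul (- c) y \<in> dom A" using xy subspace_scale by blast
    have "x - smul c y \<in> dom A" using sub xy subspace_diff subspace_scale by blast
    moreover have "app A (x - smul c y) = u - smul c v"
    proof -
      have "app A (x + smul (- c) y) = app A x + smul (- c) (app A y)"
        using assms(1) xy my unfolding linear_operator_def by metis
      then show ?thesis by (simp add: xy)
    qed
    ultimately show ?thesis by (auto simp: f_def p graph_def app_def)
  qed
  have "f ` closure (Map.graph A \<times> Map.graph A) \<subseteq> closure (Map.graph A)"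
    by (rule image_closure_subset[OF cont]) (use lin in \<open>auto intro!: subsetD[OF closure_subset]\<close>)
  then have "f ((x, u), (y, v)) \<in> closure (Map.graph A)"
    using assms(2,3) by (auto simp: closure_Times)
  then show ?thesis by (simp add: f_def)
qed

text \<open>
  The element \<open>x\<close> is \<open>(1 + \<epsilon>\<^sup>2T\<^sup>2)\<^sup>-\<^sup>1 z\<close> for the closure \<open>T\<close> of \<open>A\<close>. It minimises the functional
  on the right of the last claim, whose Euler equation says that \<open>T x\<close> is in the domain of the
  adjoint of \<open>T\<close>.
\<close>

lemma regularization_exists:
  fixes \<epsilon> :: real
  assumes lin: "linear_operator smul A" and sa: "essentially_selfadjoint ip A" and "\<epsilon> > 0"
  obtains x u w where "(x, u) \<in> closure (Map.graph A)" "(u, w) \<in> closure (Map.graph A)"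
    "x + (\<epsilon>\<^sup>2) *\<^sub>R w = z"
    "\<And>y v. (y, v) \<in> closure (Map.graph A) \<Longrightarrow> (norm (z - x))\<^sup>2 \<le> (norm (z - y))\<^sup>2 + \<epsilon>\<^sup>2 * (norm v)\<^sup>2"
proof -
  define G where "G = closure (Map.graph A)"
  have comb: "(x - smul c y, u - smul c v) \<in> G" if "(x, u) \<in> G" "(y, v) \<in> G" for c x u y v
    using linear_graph_closure[OF lin] that unfolding G_def by blast
  \<comment> \<open>Rescaling the second coordinate by \<epsilon> turns the functional into the
    squared distance from \<open>(z, 0)\<close> to a point of \<open>M\<close>, so a minimizer is a
    nearest point.\<close>
  define M where "M = {p :: 'h \<times> 'h. (fst p, (1/\<epsilon>) *\<^sub>R snd p) \<in> G}"
  have inM: "(x, \<epsilon> *\<^sub>R u) \<in> M \<longleftrightarrow> (x, u) \<in> G" for x u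
    using \<open>\<epsilon> > 0\<close> by (simp add: M_def)
  have "closed M"
  proof -
    have "closed ((\<lambda>p. (fst p, (1/\<epsilon>) *\<^sub>R snd p)) -` G)"
      by (intro closed_vimage continuous_intros) (simp add: G_def)
    then show ?thesis by (simp add: M_def vimage_def)
  qed
  have "convex M"
  proof -
    have "convex G"
    proof (rule convexI)
      fix p q :: "'h \<times> 'h" and s t :: real
      assume pq: "p \<in> G" "q \<in> G" and "0 \<le> s" "0 \<le> t" and st: "s + t = 1"
      obtain x u y v where p: "p = (x, u)" "q = (y, v)" by (metis prod.exhaust)
      have d: "(x - y, u - v) \<in> G" using comb[of x u y v 1] pq p by simp
      have "(x - t *\<^sub>R (x - y), u - t *\<^sub>R (u - v)) \<in> G"
        using comb[OF _ d, of x u "of_real t"] pq p by (simp add: scale_of_real)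
      moreover have s: "s = 1 - t" using st by simp
      ultimately show "s *\<^sub>R p + t *\<^sub>R q \<in> G" unfolding p s by (simp add: algebra_simps)
    qed
    moreover have "linear (\<lambda>p::'h \<times> 'h. (fst p, (1/\<epsilon>) *\<^sub>R snd p))"
      by (rule linearI) (auto simp: algebra_simps)
    ultimately have "convex ((\<lambda>p. (fst p, (1/\<epsilon>) *\<^sub>R snd p)) -` G)"
      using convex_linear_vimage by blast
    then show ?thesis by (simp add: M_def vimage_def)
  qed
  have "dom A \<noteq> {}" using essentially_selfadjointD(1)[OF sa] by auto
  then have "Map.graph A \<noteq> {}" by (auto simp: graph_def dom_def)
  then obtain x0 u0 where "(x0, u0) \<in> G" unfolding G_def using closure_subset by fastforce
  then have "M \<noteq> {}" using inM by auto
  have normsq: "(norm p)\<^sup>2 = (norm (fst p))\<^sup>2 + (norm (snd p))\<^sup>2" for p :: "'h \<times> 'h"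
    by (simp add: norm_prod_def)
  obtain p where p: "p \<in> M" and min: "\<And>q. q \<in> M \<Longrightarrow> norm ((z, 0) - p) \<le> norm ((z, 0) - q)"
  proof (rule nearest_point_exists[of M "(z, 0)", OF _ \<open>closed M\<close> \<open>convex M\<close> \<open>M \<noteq> {}\<close>])
    fix p q :: "'h \<times> 'h"
    show "(norm (p + q))\<^sup>2 + (norm (p - q))\<^sup>2 = 2 * (norm p)\<^sup>2 + 2 * (norm q)\<^sup>2"
      using parallelogram[of "fst p" "fst q"] parallelogram[of "snd p" "snd q"]
      by (simp add: normsq)
  qed blast
  define x where "x = fst p"
  define u where "u = (1/\<epsilon>) *\<^sub>R snd p"
  have pe: "p = (x, \<epsilon> *\<^sub>R u)" using \<open>\<epsilon> > 0\<close> by (simp add: x_def u_def)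
  have xu: "(x, u) \<in> G" using p by (simp add: pe inM)
  have le: "(norm (z - x))\<^sup>2 + (norm (\<epsilon> *\<^sub>R u))\<^sup>2 \<le> (norm (z - y))\<^sup>2 + (norm (\<epsilon> *\<^sub>R v))\<^sup>2"
    if "(y, v) \<in> G" for y v
    using power_mono[OF min[of "(y, \<epsilon> *\<^sub>R v)"], of 2] that by (simp add: inM normsq pe)
  have orth: "ip (z - x) y = of_real (\<epsilon>\<^sup>2) * ip u v" if yv: "(y, v) \<in> G" for y v
  proof -
    \<comment> \<open>The pair \<open>(z - x, - (\<epsilon> *\<^sub>R u))\<close> is minimal under
      subtraction of multiples of \<open>(y, \<epsilon> *\<^sub>R v)\<close>, which corresponds to
      adding multiples of \<open>(y, v)\<close> to \<open>(x, u)\<close>.\<close>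
    have "ip (z - x) y + ip (- (\<epsilon> *\<^sub>R u)) (\<epsilon> *\<^sub>R v) = 0"
    proof (rule orthogonal_of_minimal)
      fix c
      have "smul c (\<epsilon> *\<^sub>R v) = \<epsilon> *\<^sub>R smul c v"
        by (metis scale_of_real scale_scale mult.commute)
      moreover have "(x - smul (- c) y, u - smul (- c) v) \<in> G" by (rule comb[OF xu yv])
      ultimately show "(norm (z - x))\<^sup>2 + (norm (- (\<epsilon> *\<^sub>R u)))\<^sup>2 \<le>
          (norm (z - x - smul c y))\<^sup>2 + (norm (- (\<epsilon> *\<^sub>R u) - smul c (\<epsilon> *\<^sub>R v)))\<^sup>2"
        using le[of "x - smul (- c) y" "u - smul (- c) v"]
        by (simp add: algebra_simps norm_minus_commute)
          (metis add.commute minus_add_distrib norm_minus_cancel scaleR_right_distrib uminus_add_conv_diff)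
    qed
    then show ?thesis
      by (simp add: ip_minus_left ip_scaleR_left ip_scaleR_right power2_eq_square)
  qed
  \<comment> \<open>After division by \<open>\<epsilon>\<^sup>2\<close> the Euler equation says that
    the adjoint sends \<open>u\<close> to \<open>w\<close>; by selfadjointness \<open>w\<close> is
    the closure applied twice to \<open>x\<close>.\<close>
  define w where "w = (1/\<epsilon>\<^sup>2) *\<^sub>R (z - x)"
  have "(u, w) \<in> G" unfolding G_def
  proof (rule essentially_selfadjointD(2)[OF sa])
    fix y v assume "(y, v) \<in> closure (Map.graph A)"
    then have "ip w y = ip u v"
      using orth[of y v] \<open>\<epsilon> > 0\<close> by (simp add: G_def w_def ip_scaleR_left)
    then show "ip v u = ip y w" by (metis ip_commute)
  qed
  moreover have "x + \<epsilon>\<^sup>2 *\<^sub>R w = z" using \<open>\<epsilon> > 0\<close> by (simp add: w_def)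
  moreover have "(norm (z - x))\<^sup>2 \<le> (norm (z - y))\<^sup>2 + \<epsilon>\<^sup>2 * (norm v)\<^sup>2" if "(y, v) \<in> G" for y v
  proof -
    have "(norm (z - x))\<^sup>2 \<le> (norm (z - y))\<^sup>2 + (norm (\<epsilon> *\<^sub>R v))\<^sup>2"
      using le[OF that] zero_le_power2[of "norm (\<epsilon> *\<^sub>R u)"] by linarith
    then show ?thesis by (simp add: power_mult_distrib)
  qed
  ultimately show thesis using that xu unfolding G_def by blast
qed

text \<open>Comparison with a fixed \<open>y\<close> in the dense domain close to \<open>z\<close>:
  the first term is small for all \<open>n\<close>, the second vanishes in the limit.\<close>

lemma regularization_tendsto:
  fixes A :: "'h \<rightharpoonup> 'h"
  assumes dense: "closure (dom A) = UNIV" and \<epsilon>: "\<epsilon> \<longlonglongrightarrow> 0"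
    and le: "\<And>n y v. (y, v) \<in> closure (Map.graph A) \<Longrightarrow>
      (norm (z - x n))\<^sup>2 \<le> (norm (z - y))\<^sup>2 + (\<epsilon> n)\<^sup>2 * (norm v)\<^sup>2"
  shows "x \<longlonglongrightarrow> z"
proof (rule metric_LIMSEQ_I)
  fix r :: real assume "r > 0"
  then obtain y where y: "y \<in> dom A" "dist y z < r / 2"
    using dense by (metis UNIV_I closure_approachable half_gt_zero)
  have "(y, app A y) \<in> closure (Map.graph A)"
    using y(1) by (intro subsetD[OF closure_subset]) (auto simp: graph_def app_def)
  note le = le[OF this]
  have "(\<lambda>n. (\<epsilon> n)\<^sup>2 * (norm (app A y))\<^sup>2) \<longlonglongrightarrow> 0\<^sup>2 * (norm (app A y))\<^sup>2"
    by (intro tendsto_intros \<epsilon>)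
  \<comment> \<open>Together with \<open>(r / 2)\<^sup>2\<close> from the choice of \<open>y\<close>
    this stays below \<open>r\<^sup>2\<close>.\<close>
  then have "eventually (\<lambda>n. (\<epsilon> n)\<^sup>2 * (norm (app A y))\<^sup>2 < r\<^sup>2 / 2) sequentially"
    using \<open>r > 0\<close> by (intro order_tendstoD(2)) auto
  then obtain N where N: "\<And>n. n \<ge> N \<Longrightarrow> (\<epsilon> n)\<^sup>2 * (norm (app A y))\<^sup>2 < r\<^sup>2 / 2"
    by (auto simp: eventually_sequentially)
  have "dist (x n) z < r" if "n \<ge> N" for n
  proof -
    have "(norm (z - y))\<^sup>2 \<le> (r / 2)\<^sup>2"
      using y(2) by (intro power_mono) (auto simp: dist_norm norm_minus_commute)
    moreover have "(r / 2)\<^sup>2 = r\<^sup>2 / 4" by (simp add: power_divide)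
    ultimately have "(norm (z - x n))\<^sup>2 < r\<^sup>2"
      using le[of n] N[OF that] zero_less_power[OF \<open>r > 0\<close>, of 2]
      by linarith
    then show ?thesis
      using \<open>r > 0\<close> by (simp add: dist_norm norm_minus_commute power_less_imp_less_base)
  qed
  then show "\<exists>N. \<forall>n\<ge>N. dist (x n) z < r" by blast
qed

section \<open>Essential selfadjointness of a commuting relatively bounded perturbation\<close>

text \<open>Stated for an operator with exactly the domain of \<open>A\<close>, so that it covers
  the restrictions of both \<open>B\<close> and \<open>A + B\<close>.\<close>

lemma essentially_selfadjoint_commuting:
  assumes linA: "linear_operator smul A" and linB: "linear_operator smul B"
    and symA: "symmetric_op ip A" and symB: "symmetric_op ip B"
    and sa: "essentially_selfadjoint ip A" and bd: "rel_bounded A B" and dom: "dom B = dom A"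
    and comm: "\<And>x y. x \<in> dom A \<Longrightarrow> y \<in> dom A \<Longrightarrow> ip (app A x) (app B y) = ip (app B x) (app A y)"
  shows "essentially_selfadjoint ip B"
proof -
  define G where "G = closure (Map.graph A)"
  \<comment> \<open>\<open>(x, u, s) \<in> K\<close> encodes \<open>u = T x\<close> and \<open>s = S x\<close>; \<open>S\<close> itself is never defined.\<close>
  define K where "K = closure ((\<lambda>x. (x, app A x, app B x)) ` dom A)"
  have dense: "closure (dom A) = UNIV" by (rule essentially_selfadjointD(1)[OF sa])
  have KB: "(x, s) \<in> closure (Map.graph B)" if "(x, u, s) \<in> K" for x u s
  proof -
    have "(\<lambda>r. (fst r, snd (snd r))) ` K \<subseteq> closure (Map.graph B)"
      unfolding K_def
    proof (rule image_closure_subset)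
      show "(\<lambda>r. (fst r, snd (snd r))) ` (\<lambda>x. (x, app A x, app B x)) ` dom A
          \<subseteq> closure (Map.graph B)"
        using closure_subset[of "Map.graph B"] dom by (force simp: graph_def app_def)
    qed (auto intro!: continuous_intros)
    from subsetD[OF this imageI[OF that]] show ?thesis by simp
  qed
  have Kcomm: "ip u t = ip s v" if "(x, u, s) \<in> K" "(y, v, t) \<in> K" for x u s y v t
  proof -
    have "(\<lambda>r. ip (fst (snd (fst r))) (snd (snd (snd r)))) ((x, u, s), (y, v, t)) =
        (\<lambda>r. ip (snd (snd (fst r))) (fst (snd (snd r)))) ((x, u, s), (y, v, t))"
      by (rule eq_on_closure_Times[OF that[unfolded K_def]])
        (auto intro!: continuous_intros comm)
    then show ?thesis by simp
  qed
  have Ksym: "ip s y = ip x t" if "(x, u, s) \<in> K" "(y, v, t) \<in> K" for x u s y v t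
    using symmetric_graph_closure[OF symB KB KB] that by blast
  have Gsym: "ip u y = ip x v" if "(x, u) \<in> G" "(y, v) \<in> G" for x u y v
    using symmetric_graph_closure[OF symA] that unfolding G_def by blast
  obtain \<alpha> \<beta> where ab: "\<alpha> \<ge> 0" "\<beta> \<ge> 0"
    and rb: "\<And>x. x \<in> dom A \<Longrightarrow> (norm (app B x))\<^sup>2 \<le> \<alpha> * (norm (app A x))\<^sup>2 + \<beta> * (norm x)\<^sup>2"
    using bd unfolding rel_bounded_def by blast
  \<comment> \<open>Lipschitz constant of \<open>app B\<close> for the graph norm of
    \<open>A\<close>, from the relative bound applied to differences.\<close>
  define L where "L = sqrt (\<alpha> + \<beta>)"
  have diff: "x - y \<in> dom C" "app C (x - y) = app C x - app C y"
    if "linear_operator smul C" "x \<in> dom C" "y \<in> dom C" for C x y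
  proof -
    have xy: "x - y \<in> dom C" using that subspace_diff unfolding linear_operator_def by blast
    show "x - y \<in> dom C" by (rule xy)
    have "app C (x - y + y) = app C (x - y) + app C y"
      using that xy unfolding linear_operator_def by blast
    then show "app C (x - y) = app C x - app C y" by simp
  qed
  have Lip: "norm (app B x - app B y) \<le> L * dist (x, app A x) (y, app A y)"
    if "x \<in> dom A" "y \<in> dom A" for x y
  proof -
    have "(norm (app B x - app B y))\<^sup>2 \<le> \<alpha> * (norm (app A x - app A y))\<^sup>2 + \<beta> * (norm (x - y))\<^sup>2"
      using rb[of "x - y"] diff[OF linA that] diff[OF linB] that dom by simp
    also have "\<dots> \<le> (\<alpha> + \<beta>) * ((norm (x - y))\<^sup>2 + (norm (app A x - app A y))\<^sup>2)"
      using ab by (simp add: algebra_simps)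
    also have "\<dots> = (L * dist (x, app A x) (y, app A y))\<^sup>2"
      using ab by (simp add: L_def power_mult_distrib dist_norm norm_prod_def)
    finally show ?thesis
      by (rule power2_le_imp_le) (simp add: L_def ab)
  qed
  \<comment> \<open>The Lipschitz estimate sends sequences converging in the graph of
    \<open>A\<close> to Cauchy sequences, so \<open>S\<close> is defined on all of the domain of
    \<open>T\<close>.\<close>
  have Kext: "\<exists>s. (x, u, s) \<in> K" if "(x, u) \<in> G" for x u
  proof -
    obtain g where g: "\<And>n. g n \<in> Map.graph A" "g \<longlonglongrightarrow> (x, u)"
      using \<open>(x, u) \<in> G\<close> unfolding G_def closure_sequential by blast
    define f where "f n = fst (g n)" for n
    have f: "f n \<in> dom A" "g n = (f n, app A (f n))" for n
      using g(1)[of n] by (auto simp: f_def graph_def app_def dom_def)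
    have "Cauchy (\<lambda>n. app B (f n))"
    proof (rule metric_CauchyI)
      fix e :: real assume "0 < e"
      have "L \<ge> 0" using ab by (simp add: L_def)
      \<comment> \<open>Dividing by \<open>L + 1\<close> covers \<open>L = 0\<close> and keeps the
        final inequality strict.\<close>
      then have "e / (L + 1) > 0" using \<open>0 < e\<close> by simp
      then obtain N where N: "\<And>m n. m \<ge> N \<Longrightarrow> n \<ge> N \<Longrightarrow> dist (g m) (g n) < e / (L + 1)"
        using LIMSEQ_imp_Cauchy[OF g(2)] unfolding Cauchy_def by blast
      have "dist (app B (f m)) (app B (f n)) < e" if "m \<ge> N" "n \<ge> N" for m n
      proof -
        have "dist (app B (f m)) (app B (f n)) \<le> L * dist (g m) (g n)"
          using Lip[OF f(1) f(1), of m n] by (simp add: dist_norm[of "app B _"] f(2)[symmetric])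
        also have "\<dots> \<le> L * (e / (L + 1))"
          using N[OF that] \<open>L \<ge> 0\<close> by (intro mult_left_mono) auto
        also have "\<dots> < e" using \<open>L \<ge> 0\<close> \<open>0 < e\<close> by (simp add: field_simps)
        finally show ?thesis .
      qed
      then show "\<exists>N. \<forall>m\<ge>N. \<forall>n\<ge>N. dist (app B (f m)) (app B (f n)) < e" by blast
    qed
    then obtain s where s: "(\<lambda>n. app B (f n)) \<longlonglongrightarrow> s" using Cauchy_convergent convergent_def by blast
    have "(\<lambda>n. (f n, app A (f n), app B (f n))) \<longlonglongrightarrow> (x, u, s)"
      using tendsto_Pair[OF tendsto_fst[OF g(2)] tendsto_Pair[OF tendsto_snd[OF g(2)] s]]
      by (simp only: f(2) fst_conv snd_conv)
    then have "(x, u, s) \<in> K" unfolding K_def closure_sequential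
      by (intro exI[of _ "\<lambda>n. (f n, app A (f n), app B (f n))"] conjI allI imageI f(1))
    then show ?thesis by blast
  qed
  show ?thesis
  proof (rule essentially_selfadjointI[OF symB])
    show "closure (dom B) = UNIV" using dense dom by simp
    fix z z' assume zz': "\<And>x. x \<in> dom B \<Longrightarrow> ip (app B x) z = ip x z'"
    \<comment> \<open>By \<open>zz'\<close>, the adjoint of \<open>B\<close> sends \<open>z\<close>
      to \<open>z'\<close>; the identity extends to the closure of \<open>B\<close> and hence to
      \<open>S\<close>.\<close>
    have adj: "ip z t = ip z' y" if "(y, v, t) \<in> K" for y v t
    proof -
      have "closed {p. ip (snd p) z = ip (fst p) z'}" by (intro closed_Collect_eq continuous_intros)
      then have "closure (Map.graph B) \<subseteq> {p. ip (snd p) z = ip (fst p) z'}"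
        using zz' by (intro closure_minimal) (force simp: graph_def app_def dom_def)
      then have "ip t z = ip y z'" using KB[OF that] by auto
      then show ?thesis by (metis ip_commute)
    qed
    define \<epsilon> where "\<epsilon> n = inverse (real (Suc n))" for n
    have \<epsilon>0: "\<epsilon> n > 0" for n by (simp add: \<epsilon>_def)
    have \<epsilon>lim: "\<epsilon> \<longlonglongrightarrow> 0" unfolding \<epsilon>_def by (rule LIMSEQ_inverse_real_of_nat)
    have reg: "\<exists>x u w. (x, u) \<in> G \<and> (u, w) \<in> G \<and> x + (\<epsilon> n)\<^sup>2 *\<^sub>R w = h \<and>
        (\<forall>y v. (y, v) \<in> G \<longrightarrow> (norm (h - x))\<^sup>2 \<le> (norm (h - y))\<^sup>2 + (\<epsilon> n)\<^sup>2 * (norm v)\<^sup>2)" for n h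
      using regularization_exists[OF linA sa \<epsilon>0[of n], of h] unfolding G_def by metis
    obtain x u w where x: "\<And>n. (x n, u n) \<in> G" "\<And>n. (u n, w n) \<in> G"
        "\<And>n. x n + (\<epsilon> n)\<^sup>2 *\<^sub>R w n = z"
        "\<And>n y v. (y, v) \<in> G \<Longrightarrow> (norm (z - x n))\<^sup>2 \<le> (norm (z - y))\<^sup>2 + (\<epsilon> n)\<^sup>2 * (norm v)\<^sup>2"
      using reg[of _ z] by metis
    obtain x' u' w' where x': "\<And>n. (x' n, u' n) \<in> G" "\<And>n. (u' n, w' n) \<in> G"
        "\<And>n. x' n + (\<epsilon> n)\<^sup>2 *\<^sub>R w' n = z'"
        "\<And>n y v. (y, v) \<in> G \<Longrightarrow> (norm (z' - x' n))\<^sup>2 \<le> (norm (z' - y))\<^sup>2 + (\<epsilon> n)\<^sup>2 * (norm v)\<^sup>2"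
      using reg[of _ z'] by metis
    \<comment> \<open>Here \<open>x n\<close> is \<open>J z\<close> and \<open>x' n\<close> is
      \<open>J z'\<close>, so the claim follows from \<open>S J z = J z'\<close>.\<close>
    have mem: "(x n, x' n) \<in> closure (Map.graph B)" for n
    proof -
      obtain s s' where s: "(x n, u n, s) \<in> K" and s': "(u n, w n, s') \<in> K"
        using Kext x by metis
      have "s = x' n"
      proof (rule eq_of_ip_dense[of UNIV])
        fix v
        \<comment> \<open>Every test vector has the form
          \<open>v = y + \<epsilon>\<^sup>2 T\<^sup>2 y\<close>, that is,
          \<open>y = J v\<close>.\<close>
        obtain y p q where y: "(y, p) \<in> G" "(p, q) \<in> G" and v: "y + (\<epsilon> n)\<^sup>2 *\<^sub>R q = v"
          using reg[of n v] by blast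
        obtain t t' where t: "(y, p, t) \<in> K" and t': "(p, q, t') \<in> K" using Kext y by metis
        \<comment> \<open>The chain \<open>(T\<^sup>2 x | S y) = (S T x | T y) = (T x | S T y) = (S
          x | T\<^sup>2 y)\<close>: commutation, symmetry of \<open>S\<close>, commutation.\<close>
        have "ip (w n) t = ip s q"
          using Kcomm[OF s' t] Ksym[OF s' t'] Kcomm[OF s t'] by simp
        then have 1: "ip z t = ip s v"
          unfolding x(3)[of n, symmetric] v[symmetric]
          using Ksym[OF s t] by (simp add: ip_add_left ip_add_right ip_scaleR_left ip_scaleR_right)
        \<comment> \<open>Moving \<open>T\<close> across twice gives the symmetry of
          \<open>J\<close>.\<close>
        have "ip (w' n) y = ip (x' n) q"
          using Gsym[OF x'(2)[of n] y(1)] Gsym[OF x'(1)[of n] y(2)] by simp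
        then have 2: "ip z' y = ip (x' n) v"
          unfolding x'(3)[of n, symmetric] v[symmetric]
          by (simp add: ip_add_left ip_add_right ip_scaleR_left ip_scaleR_right)
        show "ip s v = ip (x' n) v" using 1 2 adj[OF t] by simp
      qed simp
      then show ?thesis using KB[OF s] by simp
    qed
    have "x \<longlonglongrightarrow> z" by (rule regularization_tendsto[OF dense \<epsilon>lim x(4)]) (simp add: G_def)
    moreover have "x' \<longlonglongrightarrow> z'" by (rule regularization_tendsto[OF dense \<epsilon>lim x'(4)]) (simp add: G_def)
    ultimately have "(\<lambda>n. (x n, x' n)) \<longlonglongrightarrow> (z, z')" by (rule tendsto_Pair)
    then show "(z, z') \<in> closure (Map.graph B)"
      using closed_sequentially[OF closed_closure, of "\<lambda>n. (x n, x' n)"] mem by blast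
  qed
qed

end

section \<open>Application to the restrictions of \<open>B\<close> and \<open>A + B\<close>\<close>

theorem theorem3p10:
  fixes smul :: "'k::real_or_complex \<Rightarrow> 'h::{real_normed_vector, complete_space} \<Rightarrow> 'h"
    and ip :: "'h \<Rightarrow> 'h \<Rightarrow> 'k"
    and A B :: "'h \<rightharpoonup> 'h"
  assumes "hilbert_space smul ip"
    and "linear_operator smul A" and "linear_operator smul B"
    and "symmetric_op ip A" and "symmetric_op ip B"
    and "essentially_selfadjoint ip A"
    and "rel_bounded A B"
    and "\<And>x y. x \<in> dom A \<Longrightarrow> y \<in> dom A \<Longrightarrow> ip (app A x) (app B y) = ip (app B x) (app A y)"
  shows "essentially_selfadjoint_on smul ip (op_sum A B) (dom A) \<and>
    essentially_selfadjoint_on smul ip B (dom A)"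
proof -
  interpret hilbert_space smul ip by (rule assms(1))
  have sub: "subspace (dom A)" using assms(2) by (simp add: linear_operator_def)
  have AB: "dom A \<subseteq> dom B" using assms(7) by (simp add: rel_bounded_def)
  define B0 where "B0 = B |` dom A"
  define S where "S = op_sum A B |` dom A"
  have domB0: "dom B0 = dom A" using AB by (auto simp: B0_def)
  have domS: "dom S = dom A" using AB by (auto simp: S_def op_sum_def dom_def restrict_map_def)
  have appB0: "app B0 x = app B x" if "x \<in> dom A" for x
    using that by (simp add: B0_def app_def)
  have appS: "app S x = app A x + app B x" if "x \<in> dom A" for x
    using that AB by (auto simp: S_def op_sum_def app_def)
  have addA: "app A (x + y) = app A x + app A y" and scA: "app A (smul c x) = smul c (app A x)"
    and addB: "app B (x + y) = app B x + app B y" and scB: "app B (smul c x) = smul c (app B x)"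
    if "x \<in> dom A" "y \<in> dom A" for x y c
    using assms(2,3) that subsetD[OF AB] by (simp_all add: linear_operator_def)
  have add_dom: "x + y \<in> dom A" if "x \<in> dom A" "y \<in> dom A" for x y
    using sub that by (rule subspace_add)
  have sc_dom: "smul c x \<in> dom A" if "x \<in> dom A" for c x
    using sub that by (rule subspace_scale)
  have symA: "ip (app A x) y = ip x (app A y)" if "x \<in> dom A" "y \<in> dom A" for x y
    using assms(4) that by (simp add: symmetric_op_def)
  have symB: "ip (app B x) y = ip x (app B y)" if "x \<in> dom A" "y \<in> dom A" for x y
    using assms(5) that subsetD[OF AB] by (simp add: symmetric_op_def)
  obtain \<alpha> \<beta> where ab: "\<alpha> \<ge> 0" "\<beta> \<ge> 0"
    and rb: "\<And>x. x \<in> dom A \<Longrightarrow> (norm (app B x))\<^sup>2 \<le> \<alpha> * (norm (app A x))\<^sup>2 + \<beta> * (norm x)\<^sup>2"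
    using assms(7) unfolding rel_bounded_def by blast
  have "essentially_selfadjoint ip B0"
  proof (rule essentially_selfadjoint_commuting[OF assms(2) _ assms(4) _ assms(6) _ domB0])
    show "linear_operator smul B0"
      unfolding linear_operator_def domB0
      using sub add_dom sc_dom addB scB by (simp add: appB0)
    show "symmetric_op ip B0"
      unfolding symmetric_op_def domB0 using symB by (simp add: appB0)
    show "rel_bounded A B0"
      unfolding rel_bounded_def domB0 using ab rb by (auto simp: appB0)
  qed (use assms(8) appB0 in simp)
  \<comment> \<open>The sum inherits the commutation relation because both sides gain the same term
    \<open>ip (app A x) (app A y)\<close>.\<close>
  moreover have "essentially_selfadjoint ip S"
  proof (rule essentially_selfadjoint_commuting[OF assms(2) _ assms(4) _ assms(6) _ domS])
    show "linear_operator smul S"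
      unfolding linear_operator_def domS
      using sub add_dom sc_dom addB scB addA scA by (simp add: appS algebra_simps scale_right_distrib)
    show "symmetric_op ip S"
      unfolding symmetric_op_def domS
      using symA symB by (simp add: appS ip_add_left ip_add_right)
    have "(norm (app S x))\<^sup>2 \<le> (2 + 2 * \<alpha>) * (norm (app A x))\<^sup>2 + (2 * \<beta>) * (norm x)\<^sup>2"
      if "x \<in> dom A" for x
    proof -
      \<comment> \<open>Dropping the square of the difference from the parallelogram law yields the
        factors 2 in the new relative bound.\<close>
      have "(norm (app S x))\<^sup>2 \<le> 2 * (norm (app A x))\<^sup>2 + 2 * (norm (app B x))\<^sup>2"
        using parallelogram[of "app A x" "app B x"] zero_le_power2[of "norm (app A x - app B x)"]
        unfolding appS[OF that] by linarith
      then show ?thesis using rb[OF that] by (simp add: algebra_simps)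
    qed
    then show "rel_bounded A S"
      unfolding rel_bounded_def domS using ab
      by (intro conjI exI[of _ "2 + 2 * \<alpha>"] exI[of _ "2 * \<beta>"]) auto
  qed (use assms(8) appS in \<open>simp add: ip_add_left ip_add_right\<close>)
  moreover have "dom A \<subseteq> dom (op_sum A B)"
    using AB by (auto simp: op_sum_def dom_def)
  ultimately show ?thesis
    unfolding essentially_selfadjoint_on_def B0_def S_def using sub AB by simp
qed

end
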